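(* Let $R$ be a unital ring, $M$ a unitary right $R$-module and $N\subseteq M$ a submodule. If $N\subseteq M$ is a complemented distributive submodule, then for every index set $I$ the submodule $N^{(I)}\subseteq M^{(I)}$ is a complemented distributive submodule. Conversely, if $N^{(I)}\subseteq M^{(I)}$ is a complemented distributive submodule for every index set $I$, then $N\subseteq M$ is a complemented distributive submodule.
   Context: A submodule $N\subseteq M$ is distributive if $(Y_1+Y_2)\cap N=(Y_1\cap N)+(Y_2\cap N)$ for all submodules $Y_1,Y_2\subseteq M$. A complemented distributive submodule of $M$ is a distributive submodule that is also a direct summand of $M$. $M^{(I)}$ denotes the direct sum of copies of $M$ indexed by $I$, and $N^{(I)}$ is viewed as a submodule of $M^{(I)}$ componentwise. *)

theory Defs
  imports "HOL-Algebra.Algebra"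
begin

text \<open>
  The library locale \<open>module\<close> only covers commutative rings. Here the ring is arbitrary (unital),
  and \<open>a \<odot>\<^bsub>M\<^esub> x\<close> stands for the right action \<open>x \<cdot> a\<close>; this is why \<open>smult_assoc\<close> reverses
  the order of the factors. The library locale \<open>submodule\<close> does not mention the
  multiplication of the ring, so it applies verbatim to right modules.
\<close>

locale right_module = R?: ring R + M?: abelian_group M
  for R :: "('a, 'd) ring_scheme" (structure) and M :: "('a, 'b, 'c) module_scheme" (structure) +
  assumes smult_closed:
      "\<lbrakk>a \<in> carrier R; x \<in> carrier M\<rbrakk> \<Longrightarrow> a \<odot>\<^bsub>M\<^esub> x \<in> carrier M"
    and smult_ring_add:
      "\<lbrakk>a \<in> carrier R; b \<in> carrier R; x \<in> carrier M\<rbrakk> \<Longrightarrow>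
       (a \<oplus>\<^bsub>R\<^esub> b) \<odot>\<^bsub>M\<^esub> x = a \<odot>\<^bsub>M\<^esub> x \<oplus>\<^bsub>M\<^esub> b \<odot>\<^bsub>M\<^esub> x"
    and smult_module_add:
      "\<lbrakk>a \<in> carrier R; x \<in> carrier M; y \<in> carrier M\<rbrakk> \<Longrightarrow>
       a \<odot>\<^bsub>M\<^esub> (x \<oplus>\<^bsub>M\<^esub> y) = a \<odot>\<^bsub>M\<^esub> x \<oplus>\<^bsub>M\<^esub> a \<odot>\<^bsub>M\<^esub> y"
    and smult_assoc:
      "\<lbrakk>a \<in> carrier R; b \<in> carrier R; x \<in> carrier M\<rbrakk> \<Longrightarrow>
       (a \<otimes>\<^bsub>R\<^esub> b) \<odot>\<^bsub>M\<^esub> x = b \<odot>\<^bsub>M\<^esub> (a \<odot>\<^bsub>M\<^esub> x)"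
    and smult_unit:
      "x \<in> carrier M \<Longrightarrow> \<one>\<^bsub>R\<^esub> \<odot>\<^bsub>M\<^esub> x = x"

definition distributive_submodule ::
    "('a, 'd) ring_scheme \<Rightarrow> ('a, 'b, 'c) module_scheme \<Rightarrow> 'b set \<Rightarrow> bool"
  where "distributive_submodule R M N \<longleftrightarrow>
    submodule N R M \<and>
    (\<forall>Y1 Y2. submodule Y1 R M \<longrightarrow> submodule Y2 R M \<longrightarrow>
      (Y1 <+>\<^bsub>M\<^esub> Y2) \<inter> N = (Y1 \<inter> N) <+>\<^bsub>M\<^esub> (Y2 \<inter> N))"

definition direct_summand ::
    "('a, 'd) ring_scheme \<Rightarrow> ('a, 'b, 'c) module_scheme \<Rightarrow> 'b set \<Rightarrow> bool"
  where "direct_summand R M N \<longleftrightarrow>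
    submodule N R M \<and>
    (\<exists>L. submodule L R M \<and> N <+>\<^bsub>M\<^esub> L = carrier M \<and> N \<inter> L = {\<zero>\<^bsub>M\<^esub>})"

definition complemented_distributive ::
    "('a, 'd) ring_scheme \<Rightarrow> ('a, 'b, 'c) module_scheme \<Rightarrow> 'b set \<Rightarrow> bool"
  where "complemented_distributive R M N \<longleftrightarrow>
    distributive_submodule R M N \<and> direct_summand R M N"

text \<open>
  The direct sum of copies of \<open>M\<close> indexed by \<open>I\<close>: finitely supported functions, extended by
  \<open>undefined\<close> outside \<open>I\<close>. The fields \<open>mult\<close> and \<open>one\<close> are present only because
  the record type of modules extends that of rings; they play no role in a module.
\<close>

definition direct_power ::
    "'i set \<Rightarrow> ('a, 'b, 'c) module_scheme \<Rightarrow> ('a, 'i \<Rightarrow> 'b) module"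
  where "direct_power I M =
    \<lparr>carrier = carrier (sum_group I (\<lambda>_. add_monoid M)),
     monoid.mult = undefined,
     monoid.one = undefined,
     ring.zero = \<one>\<^bsub>sum_group I (\<lambda>_. add_monoid M)\<^esub>,
     ring.add = monoid.mult (sum_group I (\<lambda>_. add_monoid M)),
     smult = (\<lambda>a f. \<lambda>i\<in>I. a \<odot>\<^bsub>M\<^esub> f i)\<rparr>"

definition power_submodule ::
    "'i set \<Rightarrow> ('a, 'b, 'c) module_scheme \<Rightarrow> 'b set \<Rightarrow> ('i \<Rightarrow> 'b) set"
  where "power_submodule I M N = {f \<in> carrier (direct_power I M). \<forall>i\<in>I. f i \<in> N}"

lemma (in right_module) smult_zero:
  assumes "a \<in> carrier R"
  shows "a \<odot>\<^bsub>M\<^esub> \<zero>\<^bsub>M\<^esub> = \<zero>\<^bsub>M\<^esub>"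
proof -
  have z: "a \<odot>\<^bsub>M\<^esub> \<zero>\<^bsub>M\<^esub> \<in> carrier M"
    using assms by (simp add: smult_closed)
  have "a \<odot>\<^bsub>M\<^esub> \<zero>\<^bsub>M\<^esub> \<oplus>\<^bsub>M\<^esub> a \<odot>\<^bsub>M\<^esub> \<zero>\<^bsub>M\<^esub> = a \<odot>\<^bsub>M\<^esub> \<zero>\<^bsub>M\<^esub>"
    using smult_module_add[OF assms, of "\<zero>\<^bsub>M\<^esub>" "\<zero>\<^bsub>M\<^esub>"] by simp
  then show ?thesis
    using z by (metis M.add.r_cancel_one')
qed

lemma (in right_module) direct_power_simps:
  shows "carrier (direct_power I M) =
      {f \<in> \<Pi>\<^sub>E i\<in>I. carrier M. finite {i \<in> I. f i \<noteq> \<zero>\<^bsub>M\<^esub>}}"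
    and "\<zero>\<^bsub>direct_power I M\<^esub> = (\<lambda>i\<in>I. \<zero>\<^bsub>M\<^esub>)"
    and "f \<oplus>\<^bsub>direct_power I M\<^esub> g = (\<lambda>i\<in>I. f i \<oplus>\<^bsub>M\<^esub> g i)"
    and "a \<odot>\<^bsub>direct_power I M\<^esub> f = (\<lambda>i\<in>I. a \<odot>\<^bsub>M\<^esub> f i)"
proof -
  have g: "group (add_monoid M)" by (rule M.a_group)
  show "carrier (direct_power I M) =
      {f \<in> \<Pi>\<^sub>E i\<in>I. carrier M. finite {i \<in> I. f i \<noteq> \<zero>\<^bsub>M\<^esub>}}"
    using g by (simp add: direct_power_def carrier_sum_group)
qed (simp_all add: direct_power_def)

lemma (in right_module) right_module_direct_power:
  "right_module R (direct_power I M)"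
proof -
  let ?S = "sum_group I (\<lambda>_. add_monoid M)"
  interpret S: group ?S
    using M.a_group by simp
  have sel: "carrier (direct_power I M) = carrier ?S" "\<zero>\<^bsub>direct_power I M\<^esub> = \<one>\<^bsub>?S\<^esub>"
    "add (direct_power I M) = monoid.mult ?S"
    by (simp_all add: direct_power_def)
  have ab: "abelian_group (direct_power I M)"
  proof (rule abelian_groupI)
    fix f g assume "f \<in> carrier (direct_power I M)" "g \<in> carrier (direct_power I M)"
    then show "f \<oplus>\<^bsub>direct_power I M\<^esub> g = g \<oplus>\<^bsub>direct_power I M\<^esub> f"
      by (auto simp: direct_power_simps PiE_iff M.a_comm fun_eq_iff)
  next
    fix f assume "f \<in> carrier (direct_power I M)"
    then show "\<exists>g\<in>carrier (direct_power I M).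
        g \<oplus>\<^bsub>direct_power I M\<^esub> f = \<zero>\<^bsub>direct_power I M\<^esub>"
      unfolding sel using S.l_inv_ex by blast
  qed (unfold sel, rule S.m_closed S.one_closed S.m_assoc S.l_one; assumption)+
  show ?thesis
  proof (intro right_module.intro right_module_axioms.intro)
    show "ring R" by (rule R.ring_axioms)
    show "abelian_group (direct_power I M)" by (rule ab)
  next
    fix a f assume a: "a \<in> carrier R" and f: "f \<in> carrier (direct_power I M)"
    have "{i \<in> I. a \<odot>\<^bsub>M\<^esub> f i \<noteq> \<zero>\<^bsub>M\<^esub>} \<subseteq> {i \<in> I. f i \<noteq> \<zero>\<^bsub>M\<^esub>}"
      using smult_zero[OF a] by auto
    with a f show "a \<odot>\<^bsub>direct_power I M\<^esub> f \<in> carrier (direct_power I M)"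
      by (auto simp: direct_power_simps PiE_iff smult_closed cong: conj_cong
          elim: finite_subset[rotated])
  qed (auto simp: direct_power_simps PiE_iff smult_closed smult_ring_add smult_module_add
      smult_assoc smult_unit extensional_def fun_eq_iff)
qed

lemma (in right_module) submodule_power_submodule:
  assumes "submodule N R M"
  shows "submodule (power_submodule I M N) R (direct_power I M)"
proof -
  interpret P: right_module R "direct_power I M" by (rule right_module_direct_power)
  interpret N: submodule N R M by (rule assms)
  have inv: "\<ominus>\<^bsub>direct_power I M\<^esub> f = (\<lambda>i\<in>I. \<ominus>\<^bsub>M\<^esub> f i)"
    if "f \<in> carrier (direct_power I M)" for f
  proof -
    have "{i \<in> I. \<ominus>\<^bsub>M\<^esub> f i \<noteq> \<zero>\<^bsub>M\<^esub>} \<subseteq> {i \<in> I. f i \<noteq> \<zero>\<^bsub>M\<^esub>}" by auto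
    then have "(\<lambda>i\<in>I. \<ominus>\<^bsub>M\<^esub> f i) \<in> carrier (direct_power I M)"
      using that by (auto simp: direct_power_simps PiE_iff cong: conj_cong
          elim: finite_subset[rotated])
    moreover have "(\<lambda>i\<in>I. \<ominus>\<^bsub>M\<^esub> f i) \<oplus>\<^bsub>direct_power I M\<^esub> f = \<zero>\<^bsub>direct_power I M\<^esub>"
      using that by (auto simp: direct_power_simps PiE_iff M.l_neg fun_eq_iff)
    ultimately show ?thesis
      using that P.M.minus_equality by blast
  qed
  have "subgroup (power_submodule I M N) (add_monoid (direct_power I M))"
  proof (rule group.subgroupI[OF P.M.a_group])
    show "power_submodule I M N \<subseteq> carrier (add_monoid (direct_power I M))"
      by (auto simp: power_submodule_def)
    have "\<zero>\<^bsub>direct_power I M\<^esub> \<in> power_submodule I M N"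
      using N.one_closed P.M.zero_closed by (simp add: power_submodule_def direct_power_simps)
    then show "power_submodule I M N \<noteq> {}" by blast
  next
    fix f assume f: "f \<in> power_submodule I M N"
    then have fc: "f \<in> carrier (direct_power I M)" by (simp add: power_submodule_def)
    have "\<ominus>\<^bsub>direct_power I M\<^esub> f \<in> power_submodule I M N"
      using P.M.a_inv_closed[OF fc] f N.m_inv_closed
      unfolding power_submodule_def inv[OF fc] by (auto simp: a_inv_def)
    then show "inv\<^bsub>add_monoid (direct_power I M)\<^esub> f \<in> power_submodule I M N"
      by (simp add: a_inv_def)
  next
    fix f g assume "f \<in> power_submodule I M N" "g \<in> power_submodule I M N"
    then show "f \<otimes>\<^bsub>add_monoid (direct_power I M)\<^esub> g \<in> power_submodule I M N"
      using P.M.a_closed[of f g] N.m_closed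
      by (auto simp: power_submodule_def direct_power_simps(3))
  qed
  moreover have "a \<odot>\<^bsub>direct_power I M\<^esub> f \<in> power_submodule I M N"
    if "a \<in> carrier R" "f \<in> power_submodule I M N" for a f
    using that P.smult_closed[of a f] N.smult_closed
    by (auto simp: power_submodule_def direct_power_simps(4))
  ultimately show ?thesis
    by (intro submodule.intro submodule_axioms.intro)
qed

end

theory Submission
  imports Defs
begin

text \<open>
  The theorem reduces to a condition on single elements. Let \<open>M = N \<oplus> L\<close>. If \<open>N\<close> is distributive,
  then for \<open>y = n + l\<close> the component \<open>n = y - l\<close> lies in \<open>(yR + L) \<inter> N = (yR \<inter> N) + (L \<inter> N) = yR \<inter> N\<close>,
  so \<open>n = yr\<close> for some ring element \<open>r\<close>; comparing components, \<open>nr = n\<close> and \<open>lr = 0\<close>. Conversely, if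
  every pair \<open>(n, l)\<close> is separated by such an \<open>r\<close>, then \<open>N \<inter> L = 0\<close>, since an \<open>x\<close> in the
  intersection satisfies \<open>x = xr = 0\<close>, and \<open>N\<close> is distributive, because every submodule contains
  the \<open>N\<close>-components \<open>n = (n + l)r\<close> of its elements (\<open>complemented_distributive_iff_separated\<close>).

  In a direct power, the pair \<open>(n, l)\<close> consists of two finitely supported families, and one
  \<open>r\<close> has to fix all values of \<open>n\<close> and kill all values of \<open>l\<close>. As in the proof of the
  Jacobson density theorem, such an \<open>r\<close> is assembled from elements that separate single pairs:
  products of them kill one more vector at a time, and passing from \<open>r\<close> to \<open>1 - r\<close> exchanges the
  vectors that are fixed with those that are killed (\<open>separation_of_finite_sets\<close>). So the
  condition passes from \<open>M\<close> to all its powers. For the converse it suffices to look at the power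
  with a singleton index set, which is a copy of \<open>M\<close>.
\<close>

section \<open>Elementary facts on right modules\<close>

lemma mem_set_add_iff:
  "x \<in> A <+>\<^bsub>M\<^esub> B \<longleftrightarrow> (\<exists>a\<in>A. \<exists>b\<in>B. x = a \<oplus>\<^bsub>M\<^esub> b)"
  by (auto simp: set_add_def set_mult_def)

definition separated ::
    "('a, 'd) ring_scheme \<Rightarrow> ('a, 'b, 'c) module_scheme \<Rightarrow> 'b set \<Rightarrow> 'b set \<Rightarrow> bool"
  where "separated R M A B \<longleftrightarrow>
    (\<forall>a\<in>A. \<forall>b\<in>B. \<exists>r\<in>carrier R. r \<odot>\<^bsub>M\<^esub> a = a \<and> r \<odot>\<^bsub>M\<^esub> b = \<zero>\<^bsub>M\<^esub>)"

context right_module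
begin

lemma submodule_subset: "submodule H R M \<Longrightarrow> H \<subseteq> carrier M"
  by (metis submodule.axioms(1) subgroup.subset partial_object.select_convs(1))

lemma submodule_carrier: "submodule H R M \<Longrightarrow> x \<in> H \<Longrightarrow> x \<in> carrier M"
  using submodule_subset by blast

lemma submodule_add:
  "submodule H R M \<Longrightarrow> x \<in> H \<Longrightarrow> y \<in> H \<Longrightarrow> x \<oplus>\<^bsub>M\<^esub> y \<in> H"
  using subgroup.m_closed[of H "add_monoid M"] by (simp add: submodule_def)

lemma submodule_zero: "submodule H R M \<Longrightarrow> \<zero>\<^bsub>M\<^esub> \<in> H"
  using subgroup.one_closed[of H "add_monoid M"] by (simp add: submodule_def)

lemma submodule_neg: "submodule H R M \<Longrightarrow> x \<in> H \<Longrightarrow> \<ominus>\<^bsub>M\<^esub> x \<in> H"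
  using subgroup.m_inv_closed[of H "add_monoid M"] by (simp add: submodule_def a_inv_def)

lemma submodule_smult:
  "submodule H R M \<Longrightarrow> r \<in> carrier R \<Longrightarrow> x \<in> H \<Longrightarrow> r \<odot>\<^bsub>M\<^esub> x \<in> H"
  by (rule submodule.smult_closed)

lemma zero_smult:
  assumes "x \<in> carrier M"
  shows "\<zero>\<^bsub>R\<^esub> \<odot>\<^bsub>M\<^esub> x = \<zero>\<^bsub>M\<^esub>"
proof -
  have z: "\<zero>\<^bsub>R\<^esub> \<odot>\<^bsub>M\<^esub> x \<in> carrier M" using assms by (simp add: smult_closed)
  have "\<zero>\<^bsub>R\<^esub> \<odot>\<^bsub>M\<^esub> x \<oplus>\<^bsub>M\<^esub> \<zero>\<^bsub>R\<^esub> \<odot>\<^bsub>M\<^esub> x = \<zero>\<^bsub>R\<^esub> \<odot>\<^bsub>M\<^esub> x"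
    using smult_ring_add[of "\<zero>\<^bsub>R\<^esub>" "\<zero>\<^bsub>R\<^esub>" x] assms by simp
  then show ?thesis using z by (metis M.add.r_cancel_one')
qed

lemma neg_smult:
  assumes "r \<in> carrier R" "x \<in> carrier M"
  shows "(\<ominus>\<^bsub>R\<^esub> r) \<odot>\<^bsub>M\<^esub> x = \<ominus>\<^bsub>M\<^esub> (r \<odot>\<^bsub>M\<^esub> x)"
proof -
  have "(\<ominus>\<^bsub>R\<^esub> r) \<odot>\<^bsub>M\<^esub> x \<oplus>\<^bsub>M\<^esub> r \<odot>\<^bsub>M\<^esub> x = \<zero>\<^bsub>M\<^esub>"
    using smult_ring_add[of "\<ominus>\<^bsub>R\<^esub> r" r x] assms by (simp add: R.l_neg zero_smult)
  then show ?thesis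
    using assms by (metis M.minus_equality R.a_inv_closed smult_closed)
qed

lemma one_minus_smult:
  assumes "r \<in> carrier R" "x \<in> carrier M"
  shows "(\<one>\<^bsub>R\<^esub> \<ominus>\<^bsub>R\<^esub> r) \<odot>\<^bsub>M\<^esub> x = x \<ominus>\<^bsub>M\<^esub> r \<odot>\<^bsub>M\<^esub> x"
  using assms by (simp add: R.minus_eq M.minus_eq smult_ring_add smult_unit neg_smult)

text \<open>
  Closure under negation follows, since \<open>-x\<close> is the multiple of \<open>x\<close> by \<open>-1\<close>.
\<close>

lemma submoduleI:
  assumes "H \<subseteq> carrier M" "\<zero>\<^bsub>M\<^esub> \<in> H"
    and "\<And>x y. x \<in> H \<Longrightarrow> y \<in> H \<Longrightarrow> x \<oplus>\<^bsub>M\<^esub> y \<in> H"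
    and sm: "\<And>r x. r \<in> carrier R \<Longrightarrow> x \<in> H \<Longrightarrow> r \<odot>\<^bsub>M\<^esub> x \<in> H"
  shows "submodule H R M"
proof (intro submodule.intro submodule_axioms.intro group.subgroupI[OF M.a_group])
  fix x assume x: "x \<in> H"
  have "(\<ominus>\<^bsub>R\<^esub> \<one>\<^bsub>R\<^esub>) \<odot>\<^bsub>M\<^esub> x = \<ominus>\<^bsub>M\<^esub> x"
    using x assms(1) by (subst neg_smult) (auto simp: smult_unit)
  then show "inv\<^bsub>add_monoid M\<^esub> x \<in> H"
    using sm[OF _ x, of "\<ominus>\<^bsub>R\<^esub> \<one>\<^bsub>R\<^esub>"] by (simp add: a_inv_def)
qed (use assms in auto)

lemma submodule_cyclic:
  assumes "x \<in> carrier M"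
  shows "submodule ((\<lambda>r. r \<odot>\<^bsub>M\<^esub> x) ` carrier R) R M"
proof (rule submoduleI)
  show "\<zero>\<^bsub>M\<^esub> \<in> (\<lambda>r. r \<odot>\<^bsub>M\<^esub> x) ` carrier R"
    using zero_smult[OF assms] by (metis R.zero_closed imageI)
  show "y \<oplus>\<^bsub>M\<^esub> z \<in> (\<lambda>r. r \<odot>\<^bsub>M\<^esub> x) ` carrier R"
    if "y \<in> (\<lambda>r. r \<odot>\<^bsub>M\<^esub> x) ` carrier R" "z \<in> (\<lambda>r. r \<odot>\<^bsub>M\<^esub> x) ` carrier R" for y z
    using that assms by (auto simp flip: smult_ring_add)
  show "s \<odot>\<^bsub>M\<^esub> y \<in> (\<lambda>r. r \<odot>\<^bsub>M\<^esub> x) ` carrier R"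
    if "s \<in> carrier R" "y \<in> (\<lambda>r. r \<odot>\<^bsub>M\<^esub> x) ` carrier R" for s y
    using that assms by (auto simp flip: smult_assoc)
qed (use assms smult_closed in auto)

section \<open>Distributivity as separation of elements\<close>

text \<open>
  The submodule to which distributivity is applied is the cyclic one generated by \<open>y = n + l\<close>.
  Writing \<open>n = y - l\<close> puts \<open>n\<close> into \<open>yR + L\<close>; the summand \<open>L\<close> contributes nothing after
  intersecting with \<open>N\<close>, so \<open>n\<close> is already a multiple of \<open>y\<close>.
\<close>

lemma separated_if_distributive:
  assumes dist: "distributive_submodule R M N" and L: "submodule L R M"
    and int: "N \<inter> L = {\<zero>\<^bsub>M\<^esub>}"
  shows "separated R M N L"
  unfolding separated_def
proof (intro ballI)
  fix n l assume n: "n \<in> N" and l: "l \<in> L"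
  have N: "submodule N R M" using dist by (simp add: distributive_submodule_def)
  have nM: "n \<in> carrier M" and lM: "l \<in> carrier M"
    using N L n l submodule_carrier by auto
  define Y where "Y = (\<lambda>r. r \<odot>\<^bsub>M\<^esub> (n \<oplus>\<^bsub>M\<^esub> l)) ` carrier R"
  have Y: "submodule Y R M" unfolding Y_def using nM lM by (intro submodule_cyclic) simp
  have "n \<oplus>\<^bsub>M\<^esub> l \<in> Y"
    unfolding Y_def using nM lM smult_unit[of "n \<oplus>\<^bsub>M\<^esub> l"] by (metis M.a_closed R.one_closed imageI)
  moreover have "n = (n \<oplus>\<^bsub>M\<^esub> l) \<oplus>\<^bsub>M\<^esub> (\<ominus>\<^bsub>M\<^esub> l)"
    using nM lM by (simp add: M.a_assoc M.r_neg)
  ultimately have "n \<in> (Y <+>\<^bsub>M\<^esub> L) \<inter> N"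
    using n l L submodule_neg mem_set_add_iff by fast
  also have "\<dots> = (Y \<inter> N) <+>\<^bsub>M\<^esub> (L \<inter> N)"
    using dist Y L by (simp add: distributive_submodule_def)
  finally have "n \<in> Y"
    using int Y submodule_carrier by (auto simp: mem_set_add_iff Int_commute)
  then obtain r where r: "r \<in> carrier R" and nr: "n = r \<odot>\<^bsub>M\<^esub> (n \<oplus>\<^bsub>M\<^esub> l)"
    unfolding Y_def by blast
  have c: "r \<odot>\<^bsub>M\<^esub> n \<in> N" "r \<odot>\<^bsub>M\<^esub> l \<in> L" "r \<odot>\<^bsub>M\<^esub> n \<in> carrier M" "r \<odot>\<^bsub>M\<^esub> l \<in> carrier M"
    using r n l N L nM lM by (auto simp: submodule_smult smult_closed)
  have eq: "n = r \<odot>\<^bsub>M\<^esub> n \<oplus>\<^bsub>M\<^esub> r \<odot>\<^bsub>M\<^esub> l"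
    using nr r nM lM by (simp add: smult_module_add)
  then have "r \<odot>\<^bsub>M\<^esub> l = \<ominus>\<^bsub>M\<^esub> (r \<odot>\<^bsub>M\<^esub> n) \<oplus>\<^bsub>M\<^esub> n"
    using c by (metis M.r_neg1)
  then have "r \<odot>\<^bsub>M\<^esub> l \<in> N"
    using c n N by (simp add: submodule_add submodule_neg)
  then have "r \<odot>\<^bsub>M\<^esub> l = \<zero>\<^bsub>M\<^esub>" using c int by blast
  with eq c r show "\<exists>r\<in>carrier R. r \<odot>\<^bsub>M\<^esub> n = n \<and> r \<odot>\<^bsub>M\<^esub> l = \<zero>\<^bsub>M\<^esub>"
    by (metis M.r_zero)
qed

lemma separated_disjoint:
  assumes "separated R M N L" "x \<in> N" "x \<in> L"
  shows "x = \<zero>\<^bsub>M\<^esub>"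
  using assms unfolding separated_def by force

text \<open>
  The scalar that separates the components of \<open>y = n + l\<close> maps \<open>y\<close> to \<open>n\<close>. Hence a submodule
  contains the \<open>N\<close>-component of each of its elements, and an element \<open>y1 + y2\<close> of \<open>N\<close> is the
  sum of the \<open>N\<close>-components of \<open>y1\<close> and \<open>y2\<close>.
\<close>

lemma distributive_if_separated:
  assumes N: "submodule N R M" and L: "submodule L R M"
    and sum: "N <+>\<^bsub>M\<^esub> L = carrier M" and sep: "separated R M N L"
  shows "distributive_submodule R M N"
proof -
  have component: "\<exists>n\<in>Y \<inter> N. \<exists>l\<in>L. y = n \<oplus>\<^bsub>M\<^esub> l" if Y: "submodule Y R M" and y: "y \<in> Y" for Y y
  proof -
    obtain n l where nl: "n \<in> N" "l \<in> L" "y = n \<oplus>\<^bsub>M\<^esub> l"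
      using sum submodule_carrier[OF Y y] by (auto simp: mem_set_add_iff simp flip: sum)
    then have M: "n \<in> carrier M" "l \<in> carrier M" using N L submodule_carrier by auto
    obtain r where "r \<in> carrier R" "r \<odot>\<^bsub>M\<^esub> n = n" "r \<odot>\<^bsub>M\<^esub> l = \<zero>\<^bsub>M\<^esub>"
      using sep nl unfolding separated_def by blast
    then have "r \<in> carrier R" "r \<odot>\<^bsub>M\<^esub> y = n" using nl M by (auto simp: smult_module_add)
    then have "n \<in> Y" using Y y submodule_smult by blast
    then show ?thesis using nl by blast
  qed
  have "(Y1 <+>\<^bsub>M\<^esub> Y2) \<inter> N = (Y1 \<inter> N) <+>\<^bsub>M\<^esub> (Y2 \<inter> N)"
    if Y: "submodule Y1 R M" "submodule Y2 R M" for Y1 Y2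
  proof
    show "(Y1 \<inter> N) <+>\<^bsub>M\<^esub> (Y2 \<inter> N) \<subseteq> (Y1 <+>\<^bsub>M\<^esub> Y2) \<inter> N"
      using submodule_add[OF N] by (fastforce simp: mem_set_add_iff)
    show "(Y1 <+>\<^bsub>M\<^esub> Y2) \<inter> N \<subseteq> (Y1 \<inter> N) <+>\<^bsub>M\<^esub> (Y2 \<inter> N)"
    proof
      fix x assume x: "x \<in> (Y1 <+>\<^bsub>M\<^esub> Y2) \<inter> N"
      then obtain y1 y2 where y: "y1 \<in> Y1" "y2 \<in> Y2" "x = y1 \<oplus>\<^bsub>M\<^esub> y2"
        by (auto simp: mem_set_add_iff)
      obtain n1 l1 where 1: "n1 \<in> Y1 \<inter> N" "l1 \<in> L" "y1 = n1 \<oplus>\<^bsub>M\<^esub> l1"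
        using component[OF Y(1) y(1)] by blast
      obtain n2 l2 where 2: "n2 \<in> Y2 \<inter> N" "l2 \<in> L" "y2 = n2 \<oplus>\<^bsub>M\<^esub> l2"
        using component[OF Y(2) y(2)] by blast
      have M: "n1 \<in> carrier M" "n2 \<in> carrier M" "l1 \<in> carrier M" "l2 \<in> carrier M"
        using 1 2 N L submodule_carrier by auto
      have eq: "x = (n1 \<oplus>\<^bsub>M\<^esub> n2) \<oplus>\<^bsub>M\<^esub> (l1 \<oplus>\<^bsub>M\<^esub> l2)"
        using y 1 2 M by (simp add: M.add.m_ac)
      have nN: "n1 \<oplus>\<^bsub>M\<^esub> n2 \<in> N" and lL: "l1 \<oplus>\<^bsub>M\<^esub> l2 \<in> L"
        using 1 2 N L submodule_add by auto
      have "l1 \<oplus>\<^bsub>M\<^esub> l2 = \<ominus>\<^bsub>M\<^esub> (n1 \<oplus>\<^bsub>M\<^esub> n2) \<oplus>\<^bsub>M\<^esub> x"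
        unfolding eq using M by (metis M.r_neg1 M.a_closed)
      then have "l1 \<oplus>\<^bsub>M\<^esub> l2 \<in> N"
        using x nN N by (simp add: submodule_add submodule_neg)
      then have "l1 \<oplus>\<^bsub>M\<^esub> l2 = \<zero>\<^bsub>M\<^esub>" using lL separated_disjoint[OF sep] by blast
      then have "x = n1 \<oplus>\<^bsub>M\<^esub> n2" using eq M by simp
      then show "x \<in> (Y1 \<inter> N) <+>\<^bsub>M\<^esub> (Y2 \<inter> N)" using 1 2 by (auto simp: mem_set_add_iff)
    qed
  qed
  then show ?thesis using N by (simp add: distributive_submodule_def)
qed

text \<open>
  Separation is a statement about pairs of elements rather than about all submodules, which
  makes it possible to check it in a direct power.
\<close>

lemma complemented_distributive_iff_separated:
  "complemented_distributive R M N \<longleftrightarrow>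
    submodule N R M \<and>
    (\<exists>L. submodule L R M \<and> N <+>\<^bsub>M\<^esub> L = carrier M \<and> separated R M N L)"
proof (intro iffI)
  assume "complemented_distributive R M N"
  then show "submodule N R M \<and>
    (\<exists>L. submodule L R M \<and> N <+>\<^bsub>M\<^esub> L = carrier M \<and> separated R M N L)"
    unfolding complemented_distributive_def direct_summand_def
    using separated_if_distributive by blast
next
  assume "submodule N R M \<and>
    (\<exists>L. submodule L R M \<and> N <+>\<^bsub>M\<^esub> L = carrier M \<and> separated R M N L)"
  then obtain L where *: "submodule N R M" "submodule L R M" "N <+>\<^bsub>M\<^esub> L = carrier M"
      "separated R M N L" by blast
  then have "N \<inter> L = {\<zero>\<^bsub>M\<^esub>}" using separated_disjoint submodule_zero by blast
  with * show "complemented_distributive R M N"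
    unfolding complemented_distributive_def direct_summand_def
    using distributive_if_separated by blast
qed

section \<open>Separation of finite sets\<close>

text \<open>
  Let \<open>r\<close> kill \<open>B\<close>, and let \<open>b\<close> be one more vector. Since \<open>Q\<close> is closed under the action,
  the hypothesis applies to the image \<open>br\<close> and gives an \<open>s\<close> with \<open>brs = 0\<close>; then \<open>rs\<close> kills
  \<open>b\<close> and all of \<open>B\<close>, and it fixes \<open>T\<close> pointwise because both factors do.
\<close>

lemma kill_finite_set:
  assumes fin: "finite B" and B: "B \<subseteq> Q"
    and T: "T \<subseteq> carrier M" and Q: "submodule Q R M"
    and one: "\<And>q. q \<in> Q \<Longrightarrow> \<exists>r\<in>carrier R. (\<forall>t\<in>T. r \<odot>\<^bsub>M\<^esub> t = t) \<and> r \<odot>\<^bsub>M\<^esub> q = \<zero>\<^bsub>M\<^esub>"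
  shows "\<exists>r\<in>carrier R. (\<forall>t\<in>T. r \<odot>\<^bsub>M\<^esub> t = t) \<and> (\<forall>b\<in>B. r \<odot>\<^bsub>M\<^esub> b = \<zero>\<^bsub>M\<^esub>)"
  using fin B
proof (induction B rule: finite_induct)
  case empty
  then show ?case using T by (intro bexI[of _ "\<one>\<^bsub>R\<^esub>"]) (auto simp: smult_unit)
next
  case (insert b B)
  then obtain r where r: "r \<in> carrier R" "\<forall>t\<in>T. r \<odot>\<^bsub>M\<^esub> t = t" "\<forall>b\<in>B. r \<odot>\<^bsub>M\<^esub> b = \<zero>\<^bsub>M\<^esub>"
    by auto
  have "r \<odot>\<^bsub>M\<^esub> b \<in> Q" using r insert.prems Q by (auto simp: submodule_smult)
  then obtain s where s: "s \<in> carrier R" "\<forall>t\<in>T. s \<odot>\<^bsub>M\<^esub> t = t" "s \<odot>\<^bsub>M\<^esub> (r \<odot>\<^bsub>M\<^esub> b) = \<zero>\<^bsub>M\<^esub>"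
    using one by blast
  have "insert b B \<subseteq> carrier M" using insert.prems Q submodule_carrier by blast
  then show ?case
    using r s T by (intro bexI[of _ "r \<otimes>\<^bsub>R\<^esub> s"]) (auto simp: smult_assoc smult_zero subset_iff)
qed

text \<open>
  The previous lemma is used twice. First, for a single \<open>n\<close> in \<open>N\<close>, it gives an \<open>r\<close> fixing \<open>n\<close>
  and killing \<open>B\<close>, so \<open>1 - r\<close> kills \<open>n\<close> and fixes \<open>B\<close>. This is its hypothesis for the roles
  exchanged, with \<open>B\<close> as the set of fixed vectors, and yields an \<open>s\<close> killing \<open>A\<close> and fixing
  \<open>B\<close>. The required element is \<open>1 - s\<close>.
\<close>

lemma separation_of_finite_sets:
  assumes N: "submodule N R M" and L: "submodule L R M" and sep: "separated R M N L"
    and A: "finite A" "A \<subseteq> N" and B: "finite B" "B \<subseteq> L"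
  shows "\<exists>r\<in>carrier R. (\<forall>a\<in>A. r \<odot>\<^bsub>M\<^esub> a = a) \<and> (\<forall>b\<in>B. r \<odot>\<^bsub>M\<^esub> b = \<zero>\<^bsub>M\<^esub>)"
proof -
  have AM: "A \<subseteq> carrier M" and BM: "B \<subseteq> carrier M"
    using A B N L submodule_carrier by auto
  have "\<exists>s\<in>carrier R. (\<forall>b\<in>B. s \<odot>\<^bsub>M\<^esub> b = b) \<and> s \<odot>\<^bsub>M\<^esub> n = \<zero>\<^bsub>M\<^esub>" if n: "n \<in> N" for n
  proof -
    have nM: "n \<in> carrier M" using N n submodule_carrier by blast
    have "\<exists>r\<in>carrier R. (\<forall>t\<in>{n}. r \<odot>\<^bsub>M\<^esub> t = t) \<and> (\<forall>b\<in>B. r \<odot>\<^bsub>M\<^esub> b = \<zero>\<^bsub>M\<^esub>)"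
      using sep n nM by (intro kill_finite_set[OF B _ L]) (auto simp: separated_def)
    then obtain r where "r \<in> carrier R" "r \<odot>\<^bsub>M\<^esub> n = n" "\<forall>b\<in>B. r \<odot>\<^bsub>M\<^esub> b = \<zero>\<^bsub>M\<^esub>" by blast
    then show ?thesis using nM BM
      by (intro bexI[of _ "\<one>\<^bsub>R\<^esub> \<ominus>\<^bsub>R\<^esub> r"])
        (auto simp: one_minus_smult subset_iff M.r_neg M.minus_eq)
  qed
  from kill_finite_set[OF A BM N this]
  obtain s where "s \<in> carrier R" "\<forall>b\<in>B. s \<odot>\<^bsub>M\<^esub> b = b" "\<forall>a\<in>A. s \<odot>\<^bsub>M\<^esub> a = \<zero>\<^bsub>M\<^esub>"
    by blast
  then show ?thesis using AM BM
    by (intro bexI[of _ "\<one>\<^bsub>R\<^esub> \<ominus>\<^bsub>R\<^esub> s"])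
      (auto simp: one_minus_smult subset_iff M.r_neg M.minus_eq)
qed

section \<open>Direct powers\<close>

text \<open>
  Scalars act componentwise and families in the power have finite support, so separating two
  families amounts to separating their finite sets of nonzero values simultaneously.
\<close>

lemma separated_power:
  assumes N: "submodule N R M" and L: "submodule L R M" and sep: "separated R M N L"
  shows "separated R (direct_power I M) (power_submodule I M N) (power_submodule I M L)"
  unfolding separated_def
proof (intro ballI)
  fix f g assume f: "f \<in> power_submodule I M N" and g: "g \<in> power_submodule I M L"
  define A where "A = f ` {i \<in> I. f i \<noteq> \<zero>\<^bsub>M\<^esub>}"
  define B where "B = g ` {i \<in> I. g i \<noteq> \<zero>\<^bsub>M\<^esub>}"
  have "finite A" "A \<subseteq> N" "finite B" "B \<subseteq> L"
    using f g by (auto simp: A_def B_def power_submodule_def direct_power_simps)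
  then obtain r where r: "r \<in> carrier R" "\<forall>a\<in>A. r \<odot>\<^bsub>M\<^esub> a = a" "\<forall>b\<in>B. r \<odot>\<^bsub>M\<^esub> b = \<zero>\<^bsub>M\<^esub>"
    using separation_of_finite_sets[OF N L sep] by blast
  have "r \<odot>\<^bsub>M\<^esub> f i = f i" "r \<odot>\<^bsub>M\<^esub> g i = \<zero>\<^bsub>M\<^esub>" if "i \<in> I" for i
    using r that smult_zero[OF r(1)]
    by (cases "f i = \<zero>\<^bsub>M\<^esub>"; cases "g i = \<zero>\<^bsub>M\<^esub>"; force simp: A_def B_def)+
  moreover have "f \<in> extensional I"
    using f by (auto simp: power_submodule_def direct_power_simps PiE_iff)
  ultimately have "r \<odot>\<^bsub>direct_power I M\<^esub> f = f"
      "r \<odot>\<^bsub>direct_power I M\<^esub> g = \<zero>\<^bsub>direct_power I M\<^esub>"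
    by (auto simp: direct_power_simps fun_eq_iff extensional_def)
  then show "\<exists>r\<in>carrier R. r \<odot>\<^bsub>direct_power I M\<^esub> f = f \<and>
      r \<odot>\<^bsub>direct_power I M\<^esub> g = \<zero>\<^bsub>direct_power I M\<^esub>"
    using r(1) by blast
qed

lemma power_sum:
  assumes N: "submodule N R M" and L: "submodule L R M" and sum: "N <+>\<^bsub>M\<^esub> L = carrier M"
  shows "power_submodule I M N <+>\<^bsub>direct_power I M\<^esub> power_submodule I M L =
    carrier (direct_power I M)"
proof
  interpret P: right_module R "direct_power I M" by (rule right_module_direct_power)
  show "power_submodule I M N <+>\<^bsub>direct_power I M\<^esub> power_submodule I M L
      \<subseteq> carrier (direct_power I M)"
    by (auto simp: mem_set_add_iff power_submodule_def)
  show "carrier (direct_power I M)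
      \<subseteq> power_submodule I M N <+>\<^bsub>direct_power I M\<^esub> power_submodule I M L"
  proof
    fix f assume f: "f \<in> carrier (direct_power I M)"
    \<comment> \<open>Zero has to be split as \<open>0 + 0\<close>, so that the components have finite support.\<close>
    have "\<exists>n l. n \<in> N \<and> l \<in> L \<and> x = n \<oplus>\<^bsub>M\<^esub> l \<and> (x = \<zero>\<^bsub>M\<^esub> \<longrightarrow> n = \<zero>\<^bsub>M\<^esub> \<and> l = \<zero>\<^bsub>M\<^esub>)"
      if "x \<in> carrier M" for x
    proof (cases "x = \<zero>\<^bsub>M\<^esub>")
      case True
      then show ?thesis
        using submodule_zero[OF N] submodule_zero[OF L] by (metis M.l_zero M.zero_closed)
    next
      case False
      have "x \<in> N <+>\<^bsub>M\<^esub> L" using that sum by simp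
      then show ?thesis using False by (auto simp: mem_set_add_iff)
    qed
    then obtain n l where nl: "\<And>x. x \<in> carrier M \<Longrightarrow> n x \<in> N \<and> l x \<in> L \<and> x = n x \<oplus>\<^bsub>M\<^esub> l x \<and>
        (x = \<zero>\<^bsub>M\<^esub> \<longrightarrow> n x = \<zero>\<^bsub>M\<^esub> \<and> l x = \<zero>\<^bsub>M\<^esub>)"
      by metis
    have fI: "f i \<in> carrier M" if "i \<in> I" for i
      using f that by (auto simp: direct_power_simps)
    have fin: "finite {i \<in> I. f i \<noteq> \<zero>\<^bsub>M\<^esub>}" and ext: "f \<in> extensional I"
      using f by (auto simp: direct_power_simps PiE_iff)
    have restr: "(\<lambda>i\<in>I. h (f i)) \<in> power_submodule I M H"
      if H: "submodule H R M" and hH: "\<And>x. x \<in> carrier M \<Longrightarrow> h x \<in> H"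
        and h0: "h \<zero>\<^bsub>M\<^esub> = \<zero>\<^bsub>M\<^esub>" for h H
    proof -
      have "{i \<in> I. h (f i) \<noteq> \<zero>\<^bsub>M\<^esub>} \<subseteq> {i \<in> I. f i \<noteq> \<zero>\<^bsub>M\<^esub>}" using h0 by auto
      then have "finite {i \<in> I. h (f i) \<noteq> \<zero>\<^bsub>M\<^esub>}" using fin finite_subset by blast
      then show ?thesis
        using hH fI submodule_carrier[OF H]
        by (auto simp: power_submodule_def direct_power_simps cong: conj_cong)
    qed
    have "(\<lambda>i\<in>I. n (f i)) \<in> power_submodule I M N" "(\<lambda>i\<in>I. l (f i)) \<in> power_submodule I M L"
      using nl by (auto intro: restr[OF N] restr[OF L])
    moreover have "f = (\<lambda>i\<in>I. n (f i)) \<oplus>\<^bsub>direct_power I M\<^esub> (\<lambda>i\<in>I. l (f i))"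
      using nl fI ext by (auto simp: direct_power_simps(3) fun_eq_iff extensional_def)
    ultimately show "f \<in> power_submodule I M N <+>\<^bsub>direct_power I M\<^esub> power_submodule I M L"
      by (auto simp: mem_set_add_iff)
  qed
qed

lemma complemented_distributive_power:
  assumes "complemented_distributive R M N"
  shows "complemented_distributive R (direct_power I M) (power_submodule I M N)"
proof -
  interpret P: right_module R "direct_power I M" by (rule right_module_direct_power)
  obtain L where L: "submodule N R M" "submodule L R M" "N <+>\<^bsub>M\<^esub> L = carrier M"
      "separated R M N L"
    using assms complemented_distributive_iff_separated by blast
  show ?thesis
    unfolding P.complemented_distributive_iff_separated
    by (intro conjI exI[of _ "power_submodule I M L"] submodule_power_submodule power_sum
        separated_power L)
qed

text \<open>
  The constant families \<open>c x\<close> identify \<open>M\<close> with the power indexed by \<open>{i}\<close>. A complement \<open>K\<close>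
  in the power need not be given as the power of a submodule, so it is pulled back along \<open>c\<close>.
\<close>

lemma complemented_distributive_singleton_power:
  assumes N: "submodule N R M"
    and pow: "complemented_distributive R (direct_power {i} M) (power_submodule {i} M N)"
  shows "complemented_distributive R M N"
proof -
  let ?P = "direct_power {i} M"
  interpret P: right_module R ?P by (rule right_module_direct_power)
  define c where "c x = (\<lambda>j\<in>{i}. x)" for x :: 'b
  have c_apply [simp]: "c x i = x" for x by (simp add: c_def)
  have c_carrier: "c x \<in> carrier ?P \<longleftrightarrow> x \<in> carrier M" for x
    by (auto simp: c_def direct_power_simps PiE_iff)
  have c_eta: "c (f i) = f" if "f \<in> carrier ?P" for f
    using that by (auto simp: c_def direct_power_simps PiE_iff extensional_def fun_eq_iff)
  have c_add: "c x \<oplus>\<^bsub>?P\<^esub> c y = c (x \<oplus>\<^bsub>M\<^esub> y)" and c_smult: "r \<odot>\<^bsub>?P\<^esub> c x = c (r \<odot>\<^bsub>M\<^esub> x)"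
    and c_zero: "\<zero>\<^bsub>?P\<^esub> = c \<zero>\<^bsub>M\<^esub>" for x y r
    by (auto simp: c_def direct_power_simps fun_eq_iff)
  have c_inj: "c x = c y \<longleftrightarrow> x = y" for x y by (metis c_apply)
  have c_N: "c x \<in> power_submodule {i} M N \<longleftrightarrow> x \<in> N" for x
    using submodule_carrier[OF N] by (auto simp: power_submodule_def c_carrier)
  obtain K where K: "submodule K R ?P" "power_submodule {i} M N <+>\<^bsub>?P\<^esub> K = carrier ?P"
      "separated R ?P (power_submodule {i} M N) K"
    using pow P.complemented_distributive_iff_separated by blast
  have "submodule {x. c x \<in> K} R M"
  proof (rule submoduleI)
    show "{x. c x \<in> K} \<subseteq> carrier M" using P.submodule_carrier[OF K(1)] c_carrier by blast
    show "\<zero>\<^bsub>M\<^esub> \<in> {x. c x \<in> K}" using P.submodule_zero[OF K(1)] by (simp add: c_zero)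
  qed (use P.submodule_add[OF K(1)] P.submodule_smult[OF K(1)] in
      \<open>auto simp flip: c_add c_smult\<close>)
  moreover have "N <+>\<^bsub>M\<^esub> {x. c x \<in> K} = carrier M"
  proof (intro equalityI subsetI)
    fix x assume "x \<in> N <+>\<^bsub>M\<^esub> {x. c x \<in> K}"
    then show "x \<in> carrier M"
      using submodule_carrier[OF N] P.submodule_carrier[OF K(1)] c_carrier
      by (auto simp: mem_set_add_iff)
  next
    fix x assume "x \<in> carrier M"
    then have "c x \<in> power_submodule {i} M N <+>\<^bsub>?P\<^esub> K" using K(2) c_carrier by simp
    then obtain f g where fg: "f \<in> power_submodule {i} M N" "g \<in> K" "c x = f \<oplus>\<^bsub>?P\<^esub> g"
      by (auto simp: mem_set_add_iff)
    have "f = c (f i)" "g = c (g i)"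
      using fg c_eta P.submodule_carrier[OF K(1)] by (auto simp: power_submodule_def)
    with fg have "f i \<in> N" "c (g i) \<in> K" "x = f i \<oplus>\<^bsub>M\<^esub> g i"
      by (metis c_N, metis, metis c_add c_inj)
    then show "x \<in> N <+>\<^bsub>M\<^esub> {x. c x \<in> K}" by (auto simp: mem_set_add_iff)
  qed
  moreover have "separated R M N {x. c x \<in> K}"
    using K(3) unfolding separated_def
    by (metis (mono_tags, lifting) c_N c_inj c_smult c_zero mem_Collect_eq)
  ultimately show ?thesis
    using N complemented_distributive_iff_separated by blast
qed

end

theorem proposition4p1:
  fixes R :: "('a, 'd) ring_scheme"
    and M :: "('a, 'b, 'c) module_scheme"
    and N :: "'b set"
  assumes "right_module R M"
    and "submodule N R M"
  shows "(complemented_distributive R M N \<longrightarrow>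
            (\<forall>I :: 'i set. complemented_distributive R (direct_power I M) (power_submodule I M N))) \<and>
         ((\<forall>I :: 'i set. complemented_distributive R (direct_power I M) (power_submodule I M N)) \<longrightarrow>
            complemented_distributive R M N)"
proof -
  interpret right_module R M by (rule assms(1))
  show ?thesis
  proof (intro conjI impI allI)
    fix I :: "'i set"
    assume "complemented_distributive R M N"
    then show "complemented_distributive R (direct_power I M) (power_submodule I M N)"
      by (rule complemented_distributive_power)
  next
    assume "\<forall>I :: 'i set. complemented_distributive R (direct_power I M) (power_submodule I M N)"
    then show "complemented_distributive R M N"
      by (intro complemented_distributive_singleton_power[OF assms(2)]) (rule spec)
  qed
qed

end
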